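(* Let $d,l\ge2$ be fixed integers and assume $$f_l\left(\tfrac1d\right):=\frac{(l-1)(d-1)}d\ln\left(\frac{d-1}d\right)-\frac1d\ln\left(\frac1d\right)<0.$$ Let $\beta_*$ be the unique solution in $(0,1/d)$ of $(1-d\beta)^l=\beta(1-\beta)^{l-1}$, let $\beta_0$ be the unique point of $(\beta_*,1/d)$ with $\Phi_{d,l}(\beta_0)=0$ (where $\Phi'_{d,l}(\beta_0)<0$), and put $$K_m:=m\beta_0+\frac{\log m}{2\Phi'_{d,l}(\beta_0)},\qquad k_m:=\lfloor K_m\rfloor.$$ Then $$\lim_{C\to\infty}\limsup_{m\to\infty}\mathbb E Z_{\ge k_m+C}=0,$$ and consequently $$\lim_{C\to\infty}\limsup_{m\to\infty}\mathbb P\{\nu_m\ge k_m+C\}=0,$$ where $\nu_m$ is the maximum cardinality of a matching of $\mathcal G_{m,d,l}$, and $m\to\infty$ through integers with $lm/d\in\mathbb N$.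
   Context: Random hypergraph model. Let $d,l\ge2$ and let $m$ be such that $lm/d\in\mathbb N$. The hyperedge set is $[m]$, the half-edge set is $[lm]$, and half-edge $i$ belongs to hyperedge $\lceil i/l\rceil$. A $(d,l)$-regular hypergraph (configuration) is obtained by partitioning $[lm]$ into $lm/d$ classes of size $d$, called vertices; a half-edge is incident to the vertex that contains it. $\mathcal G_{m,d,l}$ is the configuration given by a uniformly random such partition. A set $M$ of hyperedges is a matching if all $l|M|$ half-edges contained in hyperedges of $M$ are incident to distinct vertices. $Z_h$ is the number of matchings of $\mathcal G_{m,d,l}$ with exactly $h$ hyperedges. Notation: $H_m:=\lfloor m/d\rfloor$, $Z_{\ge k}:=\sum_{h=\lceil k\rceil}^{H_m}Z_h$, $\nu_m:=\max\{h:Z_h>0\}$, and for $0<\beta<1/d$, $$\Phi_{d,l}(\beta)=-\beta\log\beta+(l-1)(1-\beta)\log(1-\beta)-\frac ld(1-d\beta)\log(1-d\beta).$$ *)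

theory Defs
  imports "HOL-Probability.Probability" "HOL-Library.Disjoint_Sets"
begin

text \<open>
  A configuration is a partition of the half-edges \<open>1, \<dots>, l * m\<close> into vertices of size \<open>d\<close>.
  The set is nonempty exactly when \<open>d\<close> divides \<open>l * m\<close> (for \<open>d > 0\<close>); only such \<open>m\<close> are
  ever considered, see \<open>sizes_at_top\<close>.
\<close>

definition configurations :: "nat \<Rightarrow> nat \<Rightarrow> nat \<Rightarrow> nat set set set" where
  "configurations m d l = {G. partition_on {1..l * m} G \<and> (\<forall>V\<in>G. card V = d)}"

definition random_configuration :: "nat \<Rightarrow> nat \<Rightarrow> nat \<Rightarrow> nat set set pmf" where
  "random_configuration m d l = pmf_of_set (configurations m d l)"

definition hyperedge_of :: "nat \<Rightarrow> nat \<Rightarrow> nat" where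
  "hyperedge_of l i = nat \<lceil>real i / real l\<rceil>"

definition half_edges :: "nat \<Rightarrow> nat \<Rightarrow> nat set \<Rightarrow> nat set" where
  "half_edges m l M = {i \<in> {1..l * m}. hyperedge_of l i \<in> M}"

definition vertex_of :: "nat set set \<Rightarrow> nat \<Rightarrow> nat set" where
  "vertex_of G i = (THE V. V \<in> G \<and> i \<in> V)"

definition is_matching :: "nat \<Rightarrow> nat \<Rightarrow> nat set set \<Rightarrow> nat set \<Rightarrow> bool" where
  "is_matching m l G M \<longleftrightarrow> M \<subseteq> {1..m} \<and> inj_on (vertex_of G) (half_edges m l M)"

definition num_matchings :: "nat \<Rightarrow> nat \<Rightarrow> nat set set \<Rightarrow> nat \<Rightarrow> nat" where
  "num_matchings m l G h = card {M. is_matching m l G M \<and> card M = h}"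

text \<open>For \<open>k < 0\<close> the conversion \<open>nat\<close> makes the sum start at \<open>0\<close>; there are no matchings of
  negative size.\<close>

definition num_matchings_ge :: "nat \<Rightarrow> nat \<Rightarrow> nat \<Rightarrow> nat set set \<Rightarrow> real \<Rightarrow> nat" where
  "num_matchings_ge m d l G k = (\<Sum>h = nat \<lceil>k\<rceil>..nat \<lfloor>real m / real d\<rfloor>. num_matchings m l G h)"

definition matching_number :: "nat \<Rightarrow> nat \<Rightarrow> nat set set \<Rightarrow> nat" where
  "matching_number m l G = Max {h. num_matchings m l G h > 0}"

definition Phi :: "nat \<Rightarrow> nat \<Rightarrow> real \<Rightarrow> real" where
  "Phi d l \<beta> = - \<beta> * ln \<beta> + (real l - 1) * (1 - \<beta>) * ln (1 - \<beta>)
     - real l / real d * (1 - real d * \<beta>) * ln (1 - real d * \<beta>)"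

definition is_beta_star :: "nat \<Rightarrow> nat \<Rightarrow> real \<Rightarrow> bool" where
  "is_beta_star d l \<beta> \<longleftrightarrow> \<beta> \<in> {0<..<1 / real d} \<and>
     (1 - real d * \<beta>) ^ l = \<beta> * (1 - \<beta>) ^ (l - 1)"

definition beta_star :: "nat \<Rightarrow> nat \<Rightarrow> real" where
  "beta_star d l = (THE \<beta>. is_beta_star d l \<beta>)"

definition is_beta_zero :: "nat \<Rightarrow> nat \<Rightarrow> real \<Rightarrow> bool" where
  "is_beta_zero d l \<beta> \<longleftrightarrow> \<beta> \<in> {beta_star d l<..<1 / real d} \<and> Phi d l \<beta> = 0"

definition beta_zero :: "nat \<Rightarrow> nat \<Rightarrow> real" where
  "beta_zero d l = (THE \<beta>. is_beta_zero d l \<beta>)"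

definition threshold :: "nat \<Rightarrow> nat \<Rightarrow> nat \<Rightarrow> int" where
  "threshold m d l =
     \<lfloor>real m * beta_zero d l + ln (real m) / (2 * deriv (Phi d l) (beta_zero d l))\<rfloor>"

text \<open>\<open>m \<rightarrow> \<infinity>\<close> through the integers for which \<open>l * m / d\<close> is an integer.\<close>

definition sizes_at_top :: "nat \<Rightarrow> nat \<Rightarrow> nat filter" where
  "sizes_at_top d l = inf at_top (principal {m. d dvd l * m})"

end

theory Submission imports Defs "HOL-Real_Asymp.Real_Asymp" begin

text \<open>
  By symmetry and double counting, the expected number of matchings with \<open>h\<close> hyperedges is at most
  \<open>(m choose h) (k choose l h) d\<^sup>l\<^sup>h / (l m choose l h)\<close>, where \<open>k = l m / d\<close>. Stirling's bounds turn
  this into a constant times \<open>exp (m \<Phi>(h / m)) (k / (h (k - l h + 1)))\<^sup>1\<^sup>/\<^sup>2\<close>. The function \<open>\<Phi>\<close> is strictly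
  concave, so it lies below its tangent at its zero \<open>\<beta>\<^sub>0\<close>; the square-root factor is of order \<open>m\<^sup>-\<^sup>1\<^sup>/\<^sup>2\<close> near
  \<open>\<beta>\<^sub>0 m\<close>, which is compensated by the logarithmic shift in the threshold \<open>K\<^sub>m\<close>, and grows only
  polynomially in \<open>h - K\<^sub>m\<close> up to the end point. Hence the expectation decays
  exponentially in \<open>h - K\<^sub>m\<close>, uniformly in \<open>m\<close>, and the tail is a geometric series.
  The bound on the matching number is Markov's inequality.
\<close>

subsection \<open>The exponent\<close>

text \<open>With the convention \<open>ln 0 = 0\<close> the value at 0 agrees with the right limit
  there. This makes \<open>Phi\<close> continuous up to 0 and \<open>1 / d\<close>, where one of its
  logarithms degenerates.\<close>

lemma continuous_on_times_ln: "continuous_on {0..} (\<lambda>x::real. x * ln x)"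
  unfolding continuous_on_def
proof
  fix x :: real assume "x \<in> {0..}"
  then consider "x = 0" | "x > 0" by fastforce
  then show "((\<lambda>x. x * ln x) \<longlongrightarrow> x * ln x) (at x within {0..})"
  proof cases
    case 1
    have "((\<lambda>x::real. x * ln x) \<longlongrightarrow> 0) (at_right 0)"
      by real_asymp
    then show ?thesis
      using 1 by (simp add: at_within_Ici_at_right)
  next
    case 2
    then have "isCont (\<lambda>x. x * ln x) x"
      by (auto intro!: continuous_intros)
    then show ?thesis
      by (auto simp: isCont_def intro: filterlim_mono at_le)
  qed
qed

text \<open>The derivative of \<open>Phi\<close> on the open interval. The additive constants from
  differentiating \<open>x * ln x\<close> cancel, since -1 - (l - 1) + l = 0.\<close>

definition dPhi :: "nat \<Rightarrow> nat \<Rightarrow> real \<Rightarrow> real" where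
  "dPhi d l \<beta> = real l * ln (1 - real d * \<beta>) - ln \<beta> - (real l - 1) * ln (1 - \<beta>)"

text \<open>The expression in \<open>end_neg\<close> is the value of \<open>Phi\<close> at
  \<open>1 / d\<close>, where the last of its three terms vanishes.\<close>

locale matching_threshold =
  fixes d l :: nat
  assumes d_ge: "d \<ge> 2" and l_ge: "l \<ge> 2"
    and end_neg: "(real l - 1) * (real d - 1) / real d * ln ((real d - 1) / real d)
           - 1 / real d * ln (1 / real d) < 0"
begin

abbreviation "bs \<equiv> beta_star d l"
abbreviation "b0 \<equiv> beta_zero d l"

lemma less_inverse_d:
  assumes "\<beta> < 1 / real d"
  shows "real d * \<beta> < 1" "\<beta> < 1"
proof -
  show "real d * \<beta> < 1" using assms d_ge by (simp add: field_simps)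
  have "1 / real d \<le> 1" using d_ge by (simp add: field_simps)
  with assms show "\<beta> < 1" by linarith
qed

lemma le_inverse_d:
  assumes "\<beta> \<le> 1 / real d"
  shows "real d * \<beta> \<le> 1" "\<beta> < 1"
proof -
  show "real d * \<beta> \<le> 1" using assms d_ge by (simp add: field_simps)
  have "1 / real d < 1" using d_ge by (simp add: field_simps)
  with assms show "\<beta> < 1" by linarith
qed

lemma DERIV_Phi:
  assumes "0 < \<beta>" "\<beta> < 1 / real d"
  shows "(Phi d l has_real_derivative dPhi d l \<beta>) (at \<beta>)"
proof -
  have xlnx: "((\<lambda>x. g x * ln (g x)) has_real_derivative g' * (ln (g \<beta>) + 1)) (at \<beta>)"
    if "(g has_real_derivative g') (at \<beta>)" "g \<beta> > 0" for g g'
    using that by (auto intro!: derivative_eq_intros simp: algebra_simps)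
  have "((\<lambda>\<beta>. - (\<beta> * ln \<beta>) + (real l - 1) * ((1 - \<beta>) * ln (1 - \<beta>))
     - real l / real d * ((1 - real d * \<beta>) * ln (1 - real d * \<beta>))) has_real_derivative
     - (1 * (ln \<beta> + 1)) + (real l - 1) * (- 1 * (ln (1 - \<beta>) + 1))
     - real l / real d * (- real d * (ln (1 - real d * \<beta>) + 1))) (at \<beta>)"
    using less_inverse_d[OF assms(2)] assms(1)
    by (intro DERIV_add DERIV_diff DERIV_minus DERIV_cmult xlnx)
       (auto intro!: derivative_eq_intros)
  then show ?thesis
    using d_ge by (simp add: Phi_def[abs_def] dPhi_def mult.assoc algebra_simps)
qed

lemma continuous_on_Phi: "continuous_on {0..1 / real d} (Phi d l)"
proof -
  have c: "continuous_on {0..1 / real d} (\<lambda>x. g x * ln (g x))"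
    if "continuous_on {0..1 / real d} g" "\<And>x. x \<in> {0..1 / real d} \<Longrightarrow> 0 \<le> g x" for g :: "real \<Rightarrow> real"
    using that by (intro continuous_on_compose2[OF continuous_on_times_ln]) auto
  have "continuous_on {0..1 / real d} (\<lambda>\<beta>. - (\<beta> * ln \<beta>) + (real l - 1) * ((1 - \<beta>) * ln (1 - \<beta>))
     - real l / real d * ((1 - real d * \<beta>) * ln (1 - real d * \<beta>)))"
    using le_inverse_d less_imp_le
    by (intro continuous_on_add continuous_on_diff continuous_on_minus continuous_on_mult_const
          continuous_on_mult_left c) (auto intro!: continuous_intros intro: less_imp_le)
  then show ?thesis
    by (simp add: Phi_def[abs_def] mult.assoc)
qed

text \<open>Strict concavity of \<open>Phi\<close>. The only positive term of the second derivative,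
  (l - 1) / (1 - \<beta>), is dominated by l d / (1 - d \<beta>), as its numerator is smaller and
  its denominator larger.\<close>

lemma DERIV_dPhi:
  assumes "0 < \<beta>" "\<beta> < 1 / real d"
  shows "\<exists>y. (dPhi d l has_real_derivative y) (at \<beta>) \<and> y < 0"
proof (intro exI conjI)
  have pos: "real d * \<beta> < 1" "\<beta> < 1" using less_inverse_d[OF assms(2)] .
  show "(dPhi d l has_real_derivative
      - (real l * real d / (1 - real d * \<beta>)) - 1 / \<beta> + (real l - 1) / (1 - \<beta>)) (at \<beta>)"
    unfolding dPhi_def[abs_def]
    by (auto intro!: derivative_eq_intros simp: pos assms)
  have "(real l - 1) / (1 - \<beta>) \<le> real l * real d / (1 - real d * \<beta>)"
  proof (intro frac_le)
    have "real l * 1 \<le> real l * real d" using d_ge by (intro mult_left_mono) auto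
    then show "real l - 1 \<le> real l * real d" by linarith
    have "1 * \<beta> \<le> real d * \<beta>" using d_ge assms by (intro mult_right_mono) auto
    then show "1 - real d * \<beta> \<le> 1 - \<beta>" by simp
  qed (use pos l_ge in auto)
  then show "- (real l * real d / (1 - real d * \<beta>)) - 1 / \<beta> + (real l - 1) / (1 - \<beta>) < 0"
    using assms by (smt (verit) divide_pos_pos)
qed

lemma dPhi_strict_antimono:
  assumes "0 < x" "x < y" "y < 1 / real d"
  shows "dPhi d l y < dPhi d l x"
  by (rule DERIV_neg_imp_decreasing[OF assms(2)]) (use assms DERIV_dPhi in auto)

text \<open>Both sides of the polynomial equation are positive on the open interval, so taking
  logarithms is an equivalence. It identifies \<open>beta_star\<close> as the critical point of
  \<open>Phi\<close>.\<close>

lemma is_beta_star_iff: "is_beta_star d l \<beta> \<longleftrightarrow> 0 < \<beta> \<and> \<beta> < 1 / real d \<and> dPhi d l \<beta> = 0"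
proof (cases "0 < \<beta> \<and> \<beta> < 1 / real d")
  case True
  then have pos: "0 < 1 - real d * \<beta>" "0 < 1 - \<beta>" "0 < \<beta>" using less_inverse_d[of \<beta>] by auto
  have "(1 - real d * \<beta>) ^ l = \<beta> * (1 - \<beta>) ^ (l - 1) \<longleftrightarrow>
      ln ((1 - real d * \<beta>) ^ l) = ln (\<beta> * (1 - \<beta>) ^ (l - 1))"
    using pos by (subst ln_inj_iff) auto
  also have "\<dots> \<longleftrightarrow> dPhi d l \<beta> = 0"
    using pos l_ge by (simp add: ln_mult ln_realpow dPhi_def of_nat_diff algebra_simps)
  finally show ?thesis using True by (auto simp: is_beta_star_def)
qed (auto simp: is_beta_star_def)

lemma ex1_beta_star: "\<exists>!\<beta>. is_beta_star d l \<beta>"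
proof -
  \<comment> \<open>The polynomial form extends to the closed interval, whereas \<open>dPhi\<close>
    is singular at both ends. \<open>?g\<close> equals 1 at 0, so a sign change occurs. Uniqueness
    is then taken from the monotonicity of \<open>dPhi\<close>.\<close>
  let ?g = "\<lambda>\<beta>. (1 - real d * \<beta>) ^ l - \<beta> * (1 - \<beta>) ^ (l - 1)"
  have lt: "1 / real d < 1" using d_ge by (simp add: field_simps)
  have neg: "?g (1 / real d) < 0" using d_ge l_ge lt by (simp add: zero_power)
  have "\<exists>x. 0 \<le> x \<and> x \<le> 1 / real d \<and> ?g x = 0"
    using neg by (intro IVT2') (auto intro!: continuous_intros)
  then obtain x where x: "0 \<le> x" "x \<le> 1 / real d" "?g x = 0" by blast
  have "x \<noteq> 0" using x(3) by (intro notI) simp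
  moreover have "x \<noteq> 1 / real d" using x(3) neg by fastforce
  ultimately have "is_beta_star d l x" using x by (simp add: is_beta_star_def)
  moreover have "y = x" if "is_beta_star d l x" "is_beta_star d l y" for x y
    using that dPhi_strict_antimono[of x y] dPhi_strict_antimono[of y x]
    unfolding is_beta_star_iff by (metis linorder_neqE_linordered_idom less_irrefl)
  ultimately show ?thesis by blast
qed

lemma beta_star: "0 < bs" "bs < 1 / real d" "dPhi d l bs = 0"
proof -
  have "is_beta_star d l bs" unfolding beta_star_def by (rule theI'[OF ex1_beta_star])
  then show "0 < bs" "bs < 1 / real d" "dPhi d l bs = 0" by (simp_all add: is_beta_star_iff)
qed

lemma Phi_MVT:
  assumes "0 \<le> a" "a < b" "b \<le> 1 / real d"
  obtains \<xi> where "a < \<xi>" "\<xi> < b" "Phi d l b - Phi d l a = dPhi d l \<xi> * (b - a)"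
proof (rule mvt[OF assms(2)])
  show "continuous_on {a..b} (Phi d l)"
    using assms by (intro continuous_on_subset[OF continuous_on_Phi]) auto
  show "(Phi d l has_derivative (\<lambda>h. dPhi d l x * h)) (at x)" if "a < x" "x < b" for x
    using DERIV_Phi[of x] that assms by (simp add: has_field_derivative_def)
qed (use that in auto)

text \<open>\<open>Phi\<close> starts at 0 and rises up to its critical point, because
  \<open>dPhi\<close> decreases to 0 there.\<close>

lemma Phi_beta_star_pos: "0 < Phi d l bs"
proof -
  obtain \<xi> where \<xi>: "0 < \<xi>" "\<xi> < bs" "Phi d l bs - Phi d l 0 = dPhi d l \<xi> * (bs - 0)"
    using Phi_MVT[of 0 bs] beta_star by auto
  have "0 < dPhi d l \<xi>" using dPhi_strict_antimono[of \<xi> bs] \<xi> beta_star by simp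
  moreover have "Phi d l 0 = 0" by (simp add: Phi_def)
  ultimately show ?thesis using \<xi> beta_star by simp
qed

lemma Phi_strict_antimono:
  assumes "bs \<le> x" "x < y" "y \<le> 1 / real d"
  shows "Phi d l y < Phi d l x"
proof -
  obtain \<xi> where \<xi>: "x < \<xi>" "\<xi> < y" "Phi d l y - Phi d l x = dPhi d l \<xi> * (y - x)"
    using Phi_MVT[of x y] assms beta_star by auto
  have "dPhi d l \<xi> < 0" using dPhi_strict_antimono[of bs \<xi>] \<xi> beta_star assms by simp
  then have "dPhi d l \<xi> * (y - x) < 0" using assms by (simp add: mult_neg_pos)
  then show ?thesis using \<xi> by simp
qed

text \<open>\<open>Phi\<close> is positive at \<open>bs\<close>, negative at \<open>1 / d\<close> by
  \<open>end_neg\<close>, and strictly decreasing in between.\<close>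

lemma ex1_beta_zero: "\<exists>!\<beta>. is_beta_zero d l \<beta>"
proof -
  have e1: "1 - 1 / real d = (real d - 1) / real d"
    using d_ge by (simp add: diff_divide_distrib)
  have e2: "real d * (1 / real d) = 1"
    using d_ge by simp
  have "Phi d l (1 / real d) = (real l - 1) * (real d - 1) / real d * ln ((real d - 1) / real d)
           - 1 / real d * ln (1 / real d)"
    unfolding Phi_def e2 e1 by simp
  then have neg: "Phi d l (1 / real d) < 0" using end_neg by simp
  have "\<exists>x. bs \<le> x \<and> x \<le> 1 / real d \<and> Phi d l x = 0"
    using neg Phi_beta_star_pos beta_star
    by (intro IVT2' continuous_on_subset[OF continuous_on_Phi]) auto
  then obtain x where x: "bs \<le> x" "x \<le> 1 / real d" "Phi d l x = 0" by blast
  have "x \<noteq> bs" "x \<noteq> 1 / real d" using x(3) neg Phi_beta_star_pos by auto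
  then have "is_beta_zero d l x" using x by (simp add: is_beta_zero_def)
  moreover have "y = x" if "is_beta_zero d l x" "is_beta_zero d l y" for x y
    using that Phi_strict_antimono[of x y] Phi_strict_antimono[of y x]
    unfolding is_beta_zero_def by (cases x y rule: linorder_cases) auto
  ultimately show ?thesis by blast
qed

lemma beta_zero: "bs < b0" "b0 < 1 / real d" "Phi d l b0 = 0" "0 < b0"
proof -
  have "is_beta_zero d l b0" unfolding beta_zero_def by (rule theI'[OF ex1_beta_zero])
  then show "bs < b0" "b0 < 1 / real d" "Phi d l b0 = 0" "0 < b0"
    using beta_star by (auto simp: is_beta_zero_def)
qed

lemma deriv_Phi_beta_zero: "deriv (Phi d l) b0 = dPhi d l b0"
  using DERIV_Phi beta_zero by (intro DERIV_imp_deriv) auto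

lemma dPhi_beta_zero_neg: "dPhi d l b0 < 0"
  using dPhi_strict_antimono[of bs b0] beta_star beta_zero by simp

text \<open>Concavity, with the tangent at \<open>b0\<close> passing through the zero of
  \<open>Phi\<close>. The end point \<open>1 / d\<close> is included because it is attained when h =
  m / d.\<close>

lemma Phi_le_tangent:
  assumes "0 < \<beta>" "\<beta> \<le> 1 / real d"
  shows "Phi d l \<beta> \<le> dPhi d l b0 * (\<beta> - b0)"
proof (cases \<beta> b0 rule: linorder_cases)
  case less
  then obtain \<xi> where \<xi>: "\<beta> < \<xi>" "\<xi> < b0" "Phi d l b0 - Phi d l \<beta> = dPhi d l \<xi> * (b0 - \<beta>)"
    using Phi_MVT[of \<beta> b0] assms beta_zero by auto
  have "dPhi d l b0 * (b0 - \<beta>) \<le> dPhi d l \<xi> * (b0 - \<beta>)"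
    using dPhi_strict_antimono[of \<xi> b0] \<xi> assms beta_zero less by (intro mult_right_mono) auto
  then show ?thesis using \<xi> beta_zero(3) by (simp add: algebra_simps)
next
  case greater
  then obtain \<xi> where \<xi>: "b0 < \<xi>" "\<xi> < \<beta>" "Phi d l \<beta> - Phi d l b0 = dPhi d l \<xi> * (\<beta> - b0)"
    using Phi_MVT[of b0 \<beta>] assms beta_zero by auto
  have "dPhi d l \<xi> * (\<beta> - b0) \<le> dPhi d l b0 * (\<beta> - b0)"
    using dPhi_strict_antimono[of b0 \<xi>] \<xi> assms beta_zero greater by (intro mult_right_mono) auto
  then show ?thesis using \<xi> beta_zero(3) by simp
qed (simp add: beta_zero)

end

subsection \<open>Stirling bounds\<close>

text \<open>The approximation to \<open>ln (fact n)\<close> without the limiting constant ln (2 pi)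
  / 2, which lies between the bounds 3 / 4 and 1 proved below.\<close>

definition stirling :: "nat \<Rightarrow> real" where
  "stirling n = (real n + 1 / 2) * ln (real n) - real n"

text \<open>The integral of 1 / x over [n, n + 1] is bounded below by the midpoint rule and above by
  the trapezoidal rule. The first makes the error nonnegative, and the second gives 1 / (4 n (n +
  1)), written as a difference so that it telescopes.\<close>

lemma stirling_diff_bounds:
  assumes "n \<ge> 1"
  shows "ln (real (Suc n)) \<le> stirling (Suc n) - stirling n"
    and "stirling (Suc n) - stirling n \<le> ln (real (Suc n)) + 1 / (4 * real n) - 1 / (4 * real (Suc n))"
proof -
  define x where "x = real n"
  define L where "L = ln (x + 1) - ln x"
  have x: "x > 0" using assms by (simp add: x_def)
  have eq: "stirling (Suc n) - stirling n = ln (real (Suc n)) + (x + 1 / 2) * L - 1"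
    by (simp add: stirling_def x_def L_def algebra_simps)
  have "2 * (x + 1 - x) / (x + (x + 1)) \<le> L"
    unfolding L_def using x by (intro ln_inverse_approx_ge) auto
  then have "1 \<le> (x + 1 / 2) * L" using x by (simp add: field_simps)
  then show "ln (real (Suc n)) \<le> stirling (Suc n) - stirling n" using eq by simp
  have "L \<le> 1 * (inverse x + inverse (x + 1)) / 2"
    unfolding L_def using x by (intro ln_inverse_approx_le) auto
  then have "(x + 1 / 2) * L \<le> (x + 1 / 2) * ((inverse x + inverse (x + 1)) / 2)"
    using x by (intro mult_left_mono) auto
  also have "\<dots> = 1 + 1 / (4 * x) - 1 / (4 * (x + 1))"
    using x by (simp add: divide_simps) (simp add: algebra_simps)
  finally show "stirling (Suc n) - stirling n \<le> ln (real (Suc n)) + 1 / (4 * real n) - 1 / (4 * real (Suc n))"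
    using eq by (simp add: x_def add.commute)
qed

text \<open>The increments of \<open>stirling\<close> dominate those of \<open>ln (fact n)\<close>.
  The constant 1 gives equality at n = 1.\<close>

lemma ln_fact_le_stirling: "n \<ge> 1 \<Longrightarrow> ln (fact n) \<le> stirling n + 1"
proof (induction n rule: dec_induct)
  case (step n)
  have "ln (fact (Suc n) :: real) = ln (real (Suc n)) + ln (fact n)"
    unfolding fact_Suc of_nat_mult by (subst ln_mult) auto
  then show ?case using step stirling_diff_bounds(1)[of n] by simp
qed (simp add: stirling_def)

lemma stirling_le_ln_fact:
  assumes "n \<ge> 1"
  shows "stirling n + 3 / 4 \<le> ln (fact n)"
proof -
  \<comment> \<open>The extra term absorbs the telescoping error, which makes the claim inductive.
    The constant 3 / 4 gives equality at n = 1.\<close>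
  have "stirling n + 3 / 4 + 1 / (4 * real n) \<le> ln (fact n)"
    using assms
  proof (induction n rule: dec_induct)
    case (step n)
    have "ln (fact (Suc n) :: real) = ln (real (Suc n)) + ln (fact n)"
      unfolding fact_Suc of_nat_mult by (subst ln_mult) auto
    then show ?case using step stirling_diff_bounds(2)[of n] by simp
  qed (simp add: stirling_def)
  moreover have "0 \<le> 1 / (4 * real n)" by simp
  ultimately show ?thesis by linarith
qed

text \<open>Replacing \<open>ln n\<close> by \<open>ln (n + 1)\<close> in the square-root factor keeps the bound valid at \<open>n = 0\<close>.\<close>

lemma ln_fact_ge: "real n * ln (real n) - real n + ln (real n + 1) / 2 \<le> ln (fact n)"
proof (cases "n = 0")
  case False
  have "ln (real n + 1) \<le> ln (real n * 2)" using False by (subst ln_le_cancel_iff) auto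
  also have "\<dots> = ln (real n) + ln 2" using False by (subst ln_mult) auto
  also have "\<dots> \<le> ln (real n) + 1" using ln_le_minus_one[of 2] by simp
  finally show ?thesis using stirling_le_ln_fact[of n] False
    by (simp add: stirling_def algebra_simps)
qed simp

subsection \<open>Uniform partitions and matchings\<close>

text \<open>Configurations over an arbitrary ground set, so that an induction can remove one block
  together with its elements.\<close>

definition uniform_partitions :: "'a set \<Rightarrow> nat \<Rightarrow> 'a set set set" where
  "uniform_partitions A d = {G. partition_on A G \<and> (\<forall>V\<in>G. card V = d)}"

lemma card_filter_eq_sum:
  "finite A \<Longrightarrow> card {x \<in> A. P x} = (\<Sum>x\<in>A. if P x then 1 else 0)"
  by (simp add: sum.inter_filter[symmetric])

lemma finite_uniform_partitions: "finite A \<Longrightarrow> finite (uniform_partitions A d)"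
  by (rule finite_subset[of _ "Pow (Pow A)"]) (auto simp: uniform_partitions_def partition_on_def)

lemma uniform_partitions_nonempty:
  assumes "finite A" "card A = d * k" "d > 0"
  shows "uniform_partitions A d \<noteq> {}"
  using assms
proof (induction k arbitrary: A)
  case 0
  then show ?case by (auto simp: uniform_partitions_def partition_on_empty)
next
  case (Suc k)
  have "d \<le> card A" using Suc.prems by simp
  then obtain B where B: "B \<subseteq> A" "card B = d" "finite B"
    by (rule obtain_subset_with_card_n)
  have "card (A - B) = d * k"
    using B Suc.prems by (simp add: card_Diff_subset)
  then obtain G where "G \<in> uniform_partitions (A - B) d"
    using Suc.IH[of "A - B"] Suc.prems by auto
  then have G: "partition_on (A - B) G" "\<forall>V\<in>G. card V = d"
    by (auto simp: uniform_partitions_def)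
  have "B \<noteq> {}" using B Suc.prems by auto
  moreover have "\<Union>G = A - B" using G by (simp add: partition_on_def)
  ultimately have "partition_on A (insert B G)"
    using B G partition_on_insert[of B G A] by (auto simp: disjnt_def)
  then have "insert B G \<in> uniform_partitions A d"
    using B G by (simp add: uniform_partitions_def)
  then show ?case by blast
qed

lemma uniform_partitions_finite:
  assumes "finite A" "G \<in> uniform_partitions A d"
  shows "finite G" "\<And>V. V \<in> G \<Longrightarrow> finite V" "card A = d * card G"
proof -
  have p: "partition_on A G" and d: "\<And>V. V \<in> G \<Longrightarrow> card V = d"
    using assms by (auto simp: uniform_partitions_def)
  show fin: "finite G" using finite_elements[OF assms(1) p] .
  show finV: "finite V" if "V \<in> G" for V
    using p that assms(1) by (auto simp: partition_on_def intro: finite_subset)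
  have "card (\<Union>G) = sum card G"
    using p finV by (intro card_Union_disjoint) (auto simp: partition_on_def disjoint_def pairwise_def disjnt_def)
  then show "card A = d * card G" using p d by (simp add: partition_on_def)
qed

lemma vertex_of_eq:
  assumes "partition_on A G" "V \<in> G" "i \<in> V"
  shows "vertex_of G i = V"
  unfolding vertex_of_def
  using assms by (intro the_equality) (auto simp: partition_on_def disjoint_def)

lemma vertex_of_in:
  assumes "partition_on A G" "i \<in> A"
  shows "vertex_of G i \<in> G" "i \<in> vertex_of G i"
proof -
  obtain V where "V \<in> G" "i \<in> V" using assms by (auto simp: partition_on_def)
  then show "vertex_of G i \<in> G" "i \<in> vertex_of G i"
    using vertex_of_eq[OF assms(1)] by auto
qed

text \<open>Eliminates the description operator in \<open>vertex_of\<close>, leaving a condition on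
  the blocks that can be carried along a permutation.\<close>

lemma inj_on_vertex_of_iff:
  assumes "partition_on A G" "S \<subseteq> A"
  shows "inj_on (vertex_of G) S \<longleftrightarrow> (\<forall>V\<in>G. \<forall>x\<in>S \<inter> V. \<forall>y\<in>S \<inter> V. x = y)"
proof
  assume "inj_on (vertex_of G) S"
  then show "\<forall>V\<in>G. \<forall>x\<in>S \<inter> V. \<forall>y\<in>S \<inter> V. x = y"
    using vertex_of_eq[OF assms(1)] by (auto simp: inj_on_def)
next
  assume r: "\<forall>V\<in>G. \<forall>x\<in>S \<inter> V. \<forall>y\<in>S \<inter> V. x = y"
  show "inj_on (vertex_of G) S"
  proof (rule inj_onI)
    fix x y assume xy: "x \<in> S" "y \<in> S" "vertex_of G x = vertex_of G y"
    then show "x = y"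
      using r vertex_of_in[OF assms(1), of x] vertex_of_in[OF assms(1), of y] assms(2) by blast
  qed
qed

text \<open>Such a set is determined by the vertices that it meets, \<open>s\<close> of them, and by
  the element picked from each, for which there are \<open>d\<close> choices. The map
  \<open>?F\<close> records these data; applying the choice function to the vertices recovers the
  set.\<close>

lemma card_inj_vertex_of_le:
  assumes "finite A" "G \<in> uniform_partitions A d"
  shows "card {S. S \<subseteq> A \<and> card S = s \<and> inj_on (vertex_of G) S} \<le> (card G choose s) * d ^ s"
proof -
  have p: "partition_on A G" and d: "\<And>V. V \<in> G \<Longrightarrow> card V = d"
    using assms by (auto simp: uniform_partitions_def)
  note fin = uniform_partitions_finite[OF assms]
  let ?v = "vertex_of G"
  let ?X = "{S. S \<subseteq> A \<and> card S = s \<and> inj_on ?v S}"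
  let ?Y = "SIGMA T:{T. T \<subseteq> G \<and> card T = s}. PiE T (\<lambda>V. V)"
  let ?F = "\<lambda>S. (?v ` S, restrict (inv_into S ?v) (?v ` S))"
  have finT: "finite T" if "T \<subseteq> G" for T using that fin(1) by (rule finite_subset)
  have "card ?X \<le> card ?Y"
  proof (rule card_inj_on_le)
    show "inj_on ?F ?X"
    proof (rule inj_on_inverseI)
      fix S assume "S \<in> ?X"
      then show "(\<lambda>(T, f). f ` T) (?F S) = S"
        by (simp add: inv_into_image_cancel)
    qed
    show "?F ` ?X \<subseteq> ?Y"
    proof (rule image_subsetI)
      fix S assume "S \<in> ?X"
      then have S: "S \<subseteq> A" "card S = s" "inj_on ?v S" by auto
      then have "?v ` S \<subseteq> G" using vertex_of_in[OF p] by auto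
      moreover have "card (?v ` S) = s" using S by (simp add: card_image)
      moreover have "restrict (inv_into S ?v) (?v ` S) \<in> PiE (?v ` S) (\<lambda>V. V)"
        using S vertex_of_in[OF p] by (auto simp: subset_iff)
      ultimately show "?F S \<in> ?Y" by blast
    qed
    show "finite ?Y" using fin finT
      by (intro finite_SigmaI finite_PiE) auto
  qed
  also have "card ?Y = (\<Sum>T | T \<subseteq> G \<and> card T = s. card (PiE T (\<lambda>V. V)))"
    using fin finT by (intro card_SigmaI) (auto intro!: finite_PiE)
  also have "\<dots> = (\<Sum>T | T \<subseteq> G \<and> card T = s. d ^ s)"
  proof (intro sum.cong refl)
    fix T assume T: "T \<in> {T. T \<subseteq> G \<and> card T = s}"
    then have "card (PiE T (\<lambda>V. V)) = (\<Prod>V\<in>T. card V)" using finT by (intro card_PiE) auto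
    also have "\<dots> = (\<Prod>V\<in>T. d)" using T d by (intro prod.cong) auto
    finally show "card (PiE T (\<lambda>V. V)) = d ^ s" using T by simp
  qed
  also have "\<dots> = (card G choose s) * d ^ s"
    using n_subsets[OF fin(1), of s] by simp
  finally show ?thesis .
qed

text \<open>A permutation of the ground set that carries \<open>S\<close> to \<open>S'\<close> acts
  injectively on partitions, keeps block sizes, and preserves the property that no block contains
  two elements of the marked set.\<close>

lemma card_partitions_inj_le:
  assumes "finite A" "S \<subseteq> A" "S' \<subseteq> A" "card S = card S'"
  shows "card {G \<in> uniform_partitions A d. inj_on (vertex_of G) S}
     \<le> card {G \<in> uniform_partitions A d. inj_on (vertex_of G) S'}"
proof -
  have fin: "finite S" "finite S'" using assms finite_subset by auto
  then obtain f where f: "bij_betw f S S'" using assms(4) finite_same_card_bij by blast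
  have "card (A - S) = card (A - S')" using assms fin by (simp add: card_Diff_subset)
  then obtain g where g: "bij_betw g (A - S) (A - S')"
    using assms finite_same_card_bij[of "A - S" "A - S'"] by auto
  \<comment> \<open>A bijection from \<open>S\<close> to \<open>S'\<close> glued with one between
    the complements gives the permutation.\<close>
  define p where "p = (\<lambda>x. if x \<in> S then f x else g x)"
  have pS: "p ` S = S'" using f by (simp add: p_def bij_betw_def)
  have "bij_betw p (S \<union> (A - S)) (S' \<union> (A - S'))"
    unfolding p_def using f g by (intro bij_betw_disjoint_Un) auto
  then have p: "bij_betw p A A" using assms by (simp add: Un_absorb1)
  then have inj: "inj_on p A" and surj: "p ` A = A" by (auto simp: bij_betw_def)
  let ?X = "\<lambda>S. {G \<in> uniform_partitions A d. inj_on (vertex_of G) S}"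
  show ?thesis
  proof (rule card_inj_on_le[where f = "image (image p)"])
    have "inj_on (image (image p)) (Pow (Pow A))"
      by (intro inj_on_image_Pow inj)
    then show "inj_on (image (image p)) (?X S)"
      by (rule inj_on_subset) (auto simp: uniform_partitions_def partition_on_def)
    show "finite (?X S')" using finite_uniform_partitions[OF assms(1)] by simp
    show "image (image p) ` ?X S \<subseteq> ?X S'"
    proof clarify
      fix G assume G: "G \<in> uniform_partitions A d" and i: "inj_on (vertex_of G) S"
      then have pG: "partition_on A G" and dG: "\<And>V. V \<in> G \<Longrightarrow> card V = d"
        by (auto simp: uniform_partitions_def)
      have sub: "V \<subseteq> A" if "V \<in> G" for V using pG that by (auto simp: partition_on_def)
      have pG': "partition_on A ((`) p ` G)"
        unfolding partition_on_def
      proof (intro conjI)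
        show "\<Union> ((`) p ` G) = A"
          using pG surj by (simp add: partition_on_def flip: image_Union)
        show "disjoint ((`) p ` G)"
          unfolding disjoint_def
        proof clarify
          fix V W assume "V \<in> G" "W \<in> G" "p ` V \<noteq> p ` W"
          then have "V \<inter> W = {}" using pG by (auto simp: partition_on_def disjoint_def)
          then show "p ` V \<inter> p ` W = {}"
            using inj_on_image_Int[OF inj sub[OF \<open>V \<in> G\<close>] sub[OF \<open>W \<in> G\<close>]] by simp
        qed
        show "{} \<notin> (`) p ` G" using pG by (auto simp: partition_on_def)
      qed
      moreover have "card (p ` V) = d" if "V \<in> G" for V
        using that dG sub inj by (metis card_image inj_on_subset)
      ultimately have "(`) p ` G \<in> uniform_partitions A d"
        by (auto simp: uniform_partitions_def)
      moreover have "inj_on (vertex_of ((`) p ` G)) S'"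
        unfolding inj_on_vertex_of_iff[OF pG' assms(3)]
      proof (intro ballI)
        fix W x y assume W: "W \<in> (`) p ` G" and x: "x \<in> S' \<inter> W" and y: "y \<in> S' \<inter> W"
        from W obtain V where V: "V \<in> G" "W = p ` V" by auto
        have "S' \<inter> W = p ` (S \<inter> V)"
          using inj_on_image_Int[OF inj assms(2) sub[OF V(1)]] V pS by simp
        then obtain u v where uv: "u \<in> S \<inter> V" "v \<in> S \<inter> V" "x = p u" "y = p v" using x y by auto
        then have "u = v" using i V unfolding inj_on_vertex_of_iff[OF pG assms(2)] by blast
        then show "x = y" using uv by simp
      qed
      ultimately show "(`) p ` G \<in> uniform_partitions A d \<and> inj_on (vertex_of ((`) p ` G)) S'" by simp
    qed
  qed
qed

text \<open>Double counting; by symmetry all sets of size \<open>card S\<close> contribute equally.\<close>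

lemma card_partitions_inj_bound:
  assumes "finite A" "card A = d * k" "d > 0" "S \<subseteq> A"
  shows "card {G \<in> uniform_partitions A d. inj_on (vertex_of G) S} * (d * k choose card S)
     \<le> card (uniform_partitions A d) * ((k choose card S) * d ^ card S)"
proof -
  let ?U = "uniform_partitions A d" and ?s = "card S"
  let ?Q = "{S'. S' \<subseteq> A \<and> card S' = ?s}"
  note finU = finite_uniform_partitions[OF assms(1), of d]
  have finQ: "finite ?Q" using assms(1) by simp
  have "card {G \<in> ?U. inj_on (vertex_of G) S} * (d * k choose ?s)
      = (\<Sum>S'\<in>?Q. card {G \<in> ?U. inj_on (vertex_of G) S})"
    using n_subsets[OF assms(1), of ?s] assms(2) by simp
  also have "\<dots> \<le> (\<Sum>S'\<in>?Q. card {G \<in> ?U. inj_on (vertex_of G) S'})"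
    using assms by (intro sum_mono card_partitions_inj_le) auto
  also have "\<dots> = (\<Sum>S'\<in>?Q. \<Sum>G\<in>?U. if inj_on (vertex_of G) S' then 1 else 0)"
    by (intro sum.cong refl card_filter_eq_sum finU)
  also have "\<dots> = (\<Sum>G\<in>?U. \<Sum>S'\<in>?Q. if inj_on (vertex_of G) S' then 1 else 0)"
    by (rule sum.swap)
  also have "\<dots> = (\<Sum>G\<in>?U. card {S'. S' \<subseteq> A \<and> card S' = ?s \<and> inj_on (vertex_of G) S'})"
    by (intro sum.cong refl, subst card_filter_eq_sum[OF finQ, symmetric])
       (simp add: conj_assoc)
  also have "\<dots> \<le> (\<Sum>G\<in>?U. (k choose ?s) * d ^ ?s)"
  proof (rule sum_mono)
    fix G assume G: "G \<in> ?U"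
    then have "card G = k" using uniform_partitions_finite(3)[OF assms(1) G] assms by simp
    then show "card {S'. S' \<subseteq> A \<and> card S' = ?s \<and> inj_on (vertex_of G) S'} \<le> (k choose ?s) * d ^ ?s"
      using card_inj_vertex_of_le[OF assms(1) G] by simp
  qed
  finally show ?thesis by simp
qed

section \<open>Hyperedges and matchings of a configuration\<close>

lemma configurations_eq: "configurations m d l = uniform_partitions {1..l * m} d"
  by (simp add: configurations_def uniform_partitions_def)

text \<open>The value \<open>e = 0\<close> must be excluded: \<open>hyperedge_of l 0\<close> is 0,
  whereas the interval is empty for \<open>e = 0\<close>.\<close>

lemma hyperedge_of_eq_iff:
  assumes "l > 0" "e \<ge> 1"
  shows "hyperedge_of l i = e \<longleftrightarrow> i \<in> {l * (e - 1)<..l * e}"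
proof -
  have "hyperedge_of l i = e \<longleftrightarrow> \<lceil>real i / real l\<rceil> = int e"
    using assms by (auto simp: hyperedge_of_def)
  also have "\<dots> \<longleftrightarrow> real e - 1 < real i / real l \<and> real i / real l \<le> real e"
    by (simp add: ceiling_eq_iff)
  also have "\<dots> \<longleftrightarrow> real (l * (e - 1)) < real i \<and> real i \<le> real (l * e)"
    using assms by (simp add: field_simps of_nat_diff)
  finally show ?thesis by (simp only: of_nat_less_iff of_nat_le_iff greaterThanAtMost_iff)
qed

text \<open>The half-edges of distinct hyperedges form disjoint blocks of \<open>l\<close>
  consecutive integers.\<close>

lemma card_half_edges:
  assumes "l > 0" "M \<subseteq> {1..m}"
  shows "card (half_edges m l M) = l * card M"
proof -
  have "half_edges m l M = (\<Union>e\<in>M. {l * (e - 1)<..l * e})"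
  proof (intro equalityI subsetI)
    fix i assume "i \<in> half_edges m l M"
    then have e: "hyperedge_of l i \<in> M" by (simp add: half_edges_def)
    then have "1 \<le> hyperedge_of l i" using assms(2) by auto
    then show "i \<in> (\<Union>e\<in>M. {l * (e - 1)<..l * e})"
      using e hyperedge_of_eq_iff[OF assms(1), of "hyperedge_of l i" i] by blast
  next
    fix i assume "i \<in> (\<Union>e\<in>M. {l * (e - 1)<..l * e})"
    then obtain e where e: "e \<in> M" "i \<in> {l * (e - 1)<..l * e}" by blast
    have "e \<ge> 1" "e \<le> m" using e assms by auto
    moreover have "l * e \<le> l * m" using \<open>e \<le> m\<close> by simp
    ultimately show "i \<in> half_edges m l M"
      using e hyperedge_of_eq_iff[OF assms(1), of e i]
      by (auto simp: half_edges_def intro: order_trans)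
  qed
  also have "card \<dots> = (\<Sum>e\<in>M. card {l * (e - 1)<..l * e})"
  proof (rule card_UN_disjoint)
    show "finite M" using assms finite_subset by blast
    show "\<forall>i\<in>M. \<forall>j\<in>M. i \<noteq> j \<longrightarrow> {l * (i - 1)<..l * i} \<inter> {l * (j - 1)<..l * j} = {}"
    proof (intro ballI impI equals0I)
      fix i j x assume "i \<in> M" "j \<in> M" "i \<noteq> j" and x: "x \<in> {l * (i - 1)<..l * i} \<inter> {l * (j - 1)<..l * j}"
      then have "i \<ge> 1" "j \<ge> 1" using assms by auto
      then have "hyperedge_of l x = i" "hyperedge_of l x = j"
        using x hyperedge_of_eq_iff[OF assms(1)] by auto
      then show False using \<open>i \<noteq> j\<close> by simp
    qed
  qed simp
  also have "\<dots> = (\<Sum>e\<in>M. l)"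
  proof (intro sum.cong refl)
    fix e assume "e \<in> M"
    then have "e \<ge> 1" using assms by auto
    then show "card {l * (e - 1)<..l * e} = l" by (simp add: algebra_simps)
  qed
  finally show ?thesis by simp
qed

text \<open>Exchanging the sums over configurations and over sets of \<open>h\<close> hyperedges
  reduces the claim to \<open>card_partitions_inj_bound\<close>, since every such set has exactly
  \<open>l * h\<close> half-edges. Both denominators are multiplied out to stay within the natural
  numbers.\<close>

lemma sum_num_matchings_bound:
  assumes "l > 0" "d > 0" "l * m = d * k"
  shows "(\<Sum>G\<in>configurations m d l. num_matchings m l G h) * (l * m choose (l * h))
     \<le> card (configurations m d l) * ((m choose h) * ((k choose (l * h)) * d ^ (l * h)))"
proof -
  let ?U = "configurations m d l" and ?A = "{1..l * m}"
  let ?Q = "{M. M \<subseteq> {1..m} \<and> card M = h}"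
  have finU: "finite ?U" by (simp add: configurations_eq finite_uniform_partitions)
  have finQ: "finite ?Q" by simp
  have "(\<Sum>G\<in>?U. num_matchings m l G h)
      = (\<Sum>G\<in>?U. \<Sum>M\<in>?Q. if inj_on (vertex_of G) (half_edges m l M) then 1 else 0)"
    by (intro sum.cong refl, subst card_filter_eq_sum[OF finQ, symmetric])
       (simp add: num_matchings_def is_matching_def conj_ac)
  also have "\<dots> = (\<Sum>M\<in>?Q. \<Sum>G\<in>?U. if inj_on (vertex_of G) (half_edges m l M) then 1 else 0)"
    by (rule sum.swap)
  also have "\<dots> = (\<Sum>M\<in>?Q. card {G \<in> ?U. inj_on (vertex_of G) (half_edges m l M)})"
    by (intro sum.cong refl card_filter_eq_sum[symmetric] finU)
  finally have "(\<Sum>G\<in>?U. num_matchings m l G h) * (l * m choose (l * h))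
     = (\<Sum>M\<in>?Q. card {G \<in> ?U. inj_on (vertex_of G) (half_edges m l M)} * (l * m choose (l * h)))"
    by (simp add: sum_distrib_right)
  also have "\<dots> \<le> (\<Sum>M\<in>?Q. card ?U * ((k choose (l * h)) * d ^ (l * h)))"
  proof (rule sum_mono)
    fix M assume "M \<in> ?Q"
    then have "card (half_edges m l M) = l * h" using card_half_edges assms(1) by auto
    moreover have "half_edges m l M \<subseteq> ?A" by (auto simp: half_edges_def)
    ultimately show "card {G \<in> ?U. inj_on (vertex_of G) (half_edges m l M)} * (l * m choose (l * h))
       \<le> card ?U * ((k choose (l * h)) * d ^ (l * h))"
      using card_partitions_inj_bound[of ?A d k "half_edges m l M"] assms
      by (simp add: configurations_eq)
  qed
  also have "\<dots> = card ?U * ((m choose h) * ((k choose (l * h)) * d ^ (l * h)))"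
    using n_subsets[of "{1..m}" h] by simp
  finally show ?thesis .
qed

lemma configurations_nonempty:
  assumes "d > 0" "d dvd l * m"
  shows "configurations m d l \<noteq> {}"
proof -
  from assms obtain k where "l * m = d * k" by blast
  then show ?thesis using uniform_partitions_nonempty[of "{1..l * m}" d k] assms
    by (simp add: configurations_eq)
qed

lemma finite_configurations: "finite (configurations m d l)"
  by (simp add: configurations_eq finite_uniform_partitions)

text \<open>The half-edges of a matching occupy distinct vertices, of which there are only
  \<open>l * m / d\<close>.\<close>

lemma card_matching_le:
  assumes "l > 0" "d > 0" "G \<in> configurations m d l" "is_matching m l G M"
  shows "d * card M \<le> m"
proof -
  have G: "G \<in> uniform_partitions {1..l * m} d" using assms by (simp add: configurations_eq)
  then have p: "partition_on {1..l * m} G" by (simp add: uniform_partitions_def)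
  have fin: "finite G" "l * m = d * card G"
    using uniform_partitions_finite(1,3)[OF finite_atLeastAtMost G] by simp_all
  have M: "M \<subseteq> {1..m}" "inj_on (vertex_of G) (half_edges m l M)"
    using assms by (auto simp: is_matching_def)
  have "l * card M = card (half_edges m l M)" using card_half_edges M assms by simp
  also have "\<dots> \<le> card G"
    using M fin vertex_of_in[OF p] by (intro card_inj_on_le[of "vertex_of G"]) (auto simp: half_edges_def)
  finally have "d * (l * card M) \<le> d * card G" by (rule mult_left_mono) simp
  also have "\<dots> = l * m" using fin(2) ..
  finally have "l * (d * card M) \<le> l * m" by (simp only: mult.left_commute)
  then show ?thesis using assms by simp
qed

text \<open>A largest matching is itself counted: its size is at least \<open>k\<close> and, by
  \<open>card_matching_le\<close>, within the range of summation.\<close>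

lemma matching_number_le_sum:
  assumes "l > 0" "d > 0" "G \<in> configurations m d l" "k \<le> real (matching_number m l G)"
  shows "1 \<le> num_matchings_ge m d l G k"
proof -
  let ?H = "{h. num_matchings m l G h > 0}" and ?n = "matching_number m l G"
  have fin: "finite {M. is_matching m l G M \<and> card M = h}" for h
    by (rule finite_subset[of _ "Pow {1..m}"]) (auto simp: is_matching_def)
  have ex: "\<exists>M. is_matching m l G M \<and> card M = h" if "h \<in> ?H" for h
    using that by (auto simp: num_matchings_def card_gt_0_iff)
  have bound: "d * h \<le> m" if "h \<in> ?H" for h
    using ex[OF that] card_matching_le[OF assms(1-3)] by blast
  have "h \<le> m" if "h \<in> ?H" for h
    using bound[OF that] mult_le_mono1[of 1 d h] assms(2) by linarith
  then have "finite ?H" by (intro finite_subset[of ?H "{..m}"]) auto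
  \<comment> \<open>The empty matching ensures that \<open>Max\<close> is taken over a nonempty
    set.\<close>
  moreover have "0 \<in> ?H"
  proof -
    have "is_matching m l G {}" by (simp add: is_matching_def half_edges_def)
    then have "{} \<in> {M. is_matching m l G M \<and> card M = 0}" by simp
    then show ?thesis using fin[of 0] by (auto simp: num_matchings_def card_gt_0_iff)
  qed
  ultimately have n: "?n \<in> ?H" unfolding matching_number_def by (intro Max_in) auto
  have "real d * real ?n \<le> real m" using bound[OF n] of_nat_mono by fastforce
  then have "real ?n \<le> real m / real d" using assms(2) by (simp add: field_simps)
  then have up: "?n \<le> nat \<lfloor>real m / real d\<rfloor>" by (simp add: le_nat_floor)
  have low: "nat \<lceil>k\<rceil> \<le> ?n" using assms(4) by (simp add: nat_ceiling_le_eq)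
  have "1 \<le> num_matchings m l G ?n" using n by simp
  also have "\<dots> \<le> num_matchings_ge m d l G k"
    unfolding num_matchings_ge_def using up low by (intro member_le_sum) auto
  finally show ?thesis .
qed

subsection \<open>The first moment\<close>

lemma expectation_random_configuration:
  assumes "d > 0" "d dvd l * m"
  shows "measure_pmf.expectation (random_configuration m d l) f
     = (\<Sum>G\<in>configurations m d l. f G) / card (configurations m d l)"
  unfolding random_configuration_def
  using configurations_nonempty[OF assms] finite_configurations by (rule integral_pmf_of_set)

lemma expectation_num_matchings_le:
  assumes "l > 0" "d > 0" "l * m = d * k" "h \<le> m"
  shows "measure_pmf.expectation (random_configuration m d l) (\<lambda>G. real (num_matchings m l G h))
     \<le> real (m choose h) * real (k choose (l * h)) * real d ^ (l * h) / real (l * m choose (l * h))"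
proof -
  let ?N = "card (configurations m d l)"
  have dvd: "d dvd l * m" using assms(3) by simp
  have N: "?N > 0"
    using configurations_nonempty[OF assms(2) dvd] finite_configurations by (simp add: card_gt_0_iff)
  have b: "l * m choose (l * h) > 0" using assms(4) by (intro zero_less_binomial mult_le_mono2)
  have "real ((\<Sum>G\<in>configurations m d l. num_matchings m l G h) * (l * m choose (l * h)))
      \<le> real (?N * ((m choose h) * ((k choose (l * h)) * d ^ (l * h))))"
    using sum_num_matchings_bound[OF assms(1-3)] of_nat_le_iff by blast
  then have "(\<Sum>G\<in>configurations m d l. real (num_matchings m l G h)) * real (l * m choose (l * h))
      \<le> real ?N * (real (m choose h) * real (k choose (l * h)) * real d ^ (l * h))"
    by (simp only: of_nat_mult of_nat_sum of_nat_power mult.assoc)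
  then show ?thesis
    unfolding expectation_random_configuration[OF assms(2) dvd]
    using N b by (simp add: divide_simps mult.commute)
qed

section \<open>Stirling estimate of the first-moment weight\<close>

lemma ln_binomial:
  assumes "k \<le> n"
  shows "ln (real (n choose k)) = ln (fact n) - ln (fact k) - ln (fact (n - k))"
proof -
  have "real (n choose k) = fact n / (fact k * fact (n - k))"
    using assms by (rule binomial_fact)
  then show ?thesis by (simp add: ln_div ln_mult)
qed

lemma half_edges_le_vertices:
  fixes d :: nat
  assumes "d > 0" "l * m = d * k" "d * h \<le> m"
  shows "l * h \<le> k"
proof -
  have "d * (l * h) = l * (d * h)" by simp
  also have "\<dots> \<le> l * m" using assms(3) by (rule mult_le_mono2)
  finally have "d * (l * h) \<le> d * k" using assms(2) by simp
  then show ?thesis using assms(1) by simp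
qed

text \<open>The factorial of \<open>l * h\<close> cancels between two binomials, and Stirling is
  applied to the other seven. The terms of type n ln n assemble to \<open>m * Phi\<close>, the
  linear terms cancel, the half-logarithms leave the square-root factor, and the constants leave 3 *
  1 - 3 * (3 / 4) = 3 / 4.\<close>

lemma ln_matching_weight_le:
  assumes d: "d \<ge> 2" and l: "l > 0" and k: "l * m = d * k" and h: "h \<ge> 1" "d * h \<le> m"
  shows "ln (real (m choose h)) + ln (real (k choose (l * h))) + real (l * h) * ln (real d)
       - ln (real (l * m choose (l * h)))
     \<le> real m * Phi d l (real h / real m)
       + (ln (real k) - ln (real h) - ln (real k - real l * real h + 1)) / 2 + 3 / 4"
proof -
  have hm: "h < m"
  proof -
    have "2 * h \<le> d * h" using d by simp
    then show ?thesis using h by linarith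
  qed
  have lhk: "l * h \<le> k" using half_edges_le_vertices[OF _ k h(2)] d by simp
  have "0 < l * h" using l h by simp
  then have k1: "k \<ge> 1" using lhk by linarith
  define M x L D K where "M = real m" and "x = real h" and "L = real l" and "D = real d" and "K = real k"
  note defs = M_def x_def L_def D_def K_def
  have pos: "M > 0" "x > 0" "L > 0" "D > 0" "K > 0" "M - x > 0" "L * x \<le> K"
    using hm h l d k1 lhk by (auto simp: defs simp flip: of_nat_mult)
  have "D * K = L * M" unfolding defs using k by (simp flip: of_nat_mult)
  then have K: "K = L * M / D" using pos by (simp add: field_simps)
  define \<beta> where "\<beta> = x / M"
  \<comment> \<open>Every logarithm that occurs, apart from that of \<open>K - L * x + 1\<close>, is
    expressed through these six, so that the final comparison becomes a polynomial identity.\<close>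
  define a b e u v w where "a = ln M" and "b = ln L" and "e = ln D"
    and "u = ln \<beta>" and "v = ln (1 - \<beta>)" and "w = ln (1 - D * \<beta>)"
  note lndefs = a_def b_def e_def u_def v_def w_def
  have \<beta>: "\<beta> > 0" "1 - \<beta> > 0" using pos by (simp_all add: \<beta>_def)
  have "x = M * \<beta>" "M - x = M * (1 - \<beta>)" using pos by (simp_all add: \<beta>_def field_simps)
  then have lnx: "ln x = a + u" "ln (M - x) = a + v"
    using pos \<beta> by (auto simp: lndefs ln_mult)
  have lnK: "ln K = a + b - e" using pos by (simp add: K lndefs ln_mult ln_div)
  have KLx: "K - L * x = K * (1 - D * \<beta>)" using pos by (simp add: K \<beta>_def field_simps)
  \<comment> \<open>If k = l h, then \<open>w\<close> is not the logarithm of a positive number, but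
    the vanishing factor makes both sides 0.\<close>
  have lnKLx: "(K - L * x) * ln (K - L * x) = (K - L * x) * (a + b - e + w)"
  proof (cases "K - L * x = 0")
    case False
    then have "1 - D * \<beta> > 0" using pos KLx by (metis diff_ge_0_iff_ge less_eq_real_def zero_less_mult_pos)
    then have "ln (K - L * x) = ln K + w" unfolding KLx w_def using pos by (simp add: ln_mult)
    then show ?thesis using lnK by simp
  qed simp
  \<comment> \<open>Treating the quotient as an atom keeps division out of the call of
    \<open>algebra\<close>.\<close>
  define q where "q = L / D * (1 - D * \<beta>)"
  have "Phi d l \<beta> = - \<beta> * u + (L - 1) * (1 - \<beta>) * v - q * w"
    unfolding Phi_def defs[symmetric] lndefs[symmetric] q_def ..
  then have "M * Phi d l \<beta> = - (M * \<beta>) * u + (L - 1) * (M * (1 - \<beta>)) * v - (M * q) * w"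
    by algebra
  moreover have "M * q = K - L * x"
    unfolding q_def KLx by (simp add: K)
  ultimately have Phi: "M * Phi d l \<beta> = - x * u + (L - 1) * (M - x) * v - (K - L * x) * w"
    by (simp only: \<open>x = M * \<beta>\<close>[symmetric] \<open>M - x = M * (1 - \<beta>)\<close>[symmetric])
  have r: "real (m - h) = M - x" "real (k - l * h) = K - L * x" "real (l * m) = L * M"
      "real (l * m - l * h) = L * (M - x)" "real (l * h) = L * x"
    using hm lhk by (simp_all add: defs of_nat_diff right_diff_distrib)
  have "ln (real (m choose h)) + ln (real (k choose (l * h))) + real (l * h) * ln (real d)
       - ln (real (l * m choose (l * h)))
     = ln (fact m) - ln (fact h) - ln (fact (m - h)) + ln (fact k) - ln (fact (k - l * h))
       + L * x * e - ln (fact (l * m)) + ln (fact (l * m - l * h))"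
    using hm lhk by (simp add: ln_binomial r defs e_def)
  moreover have "ln (fact m) \<le> (M + 1 / 2) * a - M + 1"
    using ln_fact_le_stirling[of m] hm by (simp add: stirling_def M_def a_def)
  moreover have "ln (fact k) \<le> (K + 1 / 2) * (a + b - e) - K + 1"
    using ln_fact_le_stirling[of k] k1 unfolding stirling_def K_def[symmetric] lnK by simp
  moreover have "ln (fact (l * m - l * h)) \<le> (L * (M - x) + 1 / 2) * (b + (a + v)) - L * (M - x) + 1"
  proof -
    have "l * m - l * h \<ge> 1" using hm l by (simp add: Suc_leI)
    moreover have "ln (L * (M - x)) = b + (a + v)" using pos lnx by (simp add: ln_mult b_def)
    ultimately show ?thesis
      using ln_fact_le_stirling[of "l * m - l * h"] unfolding stirling_def r by simp
  qed
  moreover have "(x + 1 / 2) * (a + u) - x + 3 / 4 \<le> ln (fact h)"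
    using stirling_le_ln_fact[of h] h unfolding stirling_def x_def[symmetric] lnx by simp
  moreover have "(M - x + 1 / 2) * (a + v) - (M - x) + 3 / 4 \<le> ln (fact (m - h))"
    using stirling_le_ln_fact[of "m - h"] hm unfolding stirling_def r lnx by simp
  moreover have "(K - L * x) * (a + b - e + w) - (K - L * x) + ln (K - L * x + 1) / 2 \<le> ln (fact (k - l * h))"
    using ln_fact_ge[of "k - l * h"] unfolding r lnKLx by simp
  moreover have "(L * M + 1 / 2) * (b + a) - L * M + 3 / 4 \<le> ln (fact (l * m))"
  proof -
    have "l * m \<ge> 1" using hm l by (simp add: Suc_leI)
    moreover have "ln (L * M) = b + a" using pos by (simp add: ln_mult b_def a_def)
    ultimately show ?thesis
      using stirling_le_ln_fact[of "l * m"] unfolding stirling_def r by simp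
  qed
  moreover have "(M + 1 / 2) * a - M + 1 + ((K + 1 / 2) * (a + b - e) - K + 1)
      + ((L * (M - x) + 1 / 2) * (b + (a + v)) - L * (M - x) + 1)
      - ((x + 1 / 2) * (a + u) - x + 3 / 4) - ((M - x + 1 / 2) * (a + v) - (M - x) + 3 / 4)
      - ((K - L * x) * (a + b - e + w) - (K - L * x) + ln (K - L * x + 1) / 2)
      - ((L * M + 1 / 2) * (b + a) - L * M + 3 / 4) + L * x * e
    = M * Phi d l \<beta> + ((a + b - e) - (a + u) - ln (K - L * x + 1)) / 2 + 3 / 4"
    unfolding Phi by (simp add: field_simps)
  ultimately show ?thesis
    unfolding defs[symmetric] \<beta>_def[symmetric] lnx lnK by linarith
qed

section \<open>Exponential decay above the threshold\<close>

context matching_threshold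
begin

definition rate :: real where
  "rate = - dPhi d l b0"

text \<open>\<open>centre m\<close> is \<open>K\<^sub>m\<close> of the paper.\<close>

definition centre :: "nat \<Rightarrow> real" where
  "centre m = real m * b0 - ln (real m) / (2 * rate)"

lemma rate_pos: "rate > 0"
  using dPhi_beta_zero_neg by (simp add: rate_def)

lemma threshold_eq: "threshold m d l = \<lfloor>centre m\<rfloor>"
  by (simp add: threshold_def centre_def rate_def deriv_Phi_beta_zero)

text \<open>With i = h - \<open>centre m\<close>, the tangent bound contributes -
  \<open>rate\<close> i + ln m / 2, and the square-root factor contributes at most (ln (1 + i) - ln
  m) / 2 plus a constant. The terms ln m cancel by the choice of the centre, and half of the rate is
  given up to absorb ln (1 + i). The bound \<open>b0 * real m / 2 \<le> real h\<close> keeps k / h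
  bounded.\<close>

lemma expectation_num_matchings_exponential:
  obtains c where "\<And>m h. d dvd l * m \<Longrightarrow> h \<ge> 1 \<Longrightarrow> d * h \<le> m \<Longrightarrow> b0 * real m / 2 \<le> real h
      \<Longrightarrow> centre m \<le> real h
      \<Longrightarrow> measure_pmf.expectation (random_configuration m d l) (\<lambda>G. real (num_matchings m l G h))
          \<le> exp (c - rate / 2 * (real h - centre m))"
proof
  \<comment> \<open>Positive because \<open>b0\<close> lies strictly inside the interval; hence k -
    l h is of order m for h near \<open>b0 * m\<close>.\<close>
  define gap where "gap = 1 / real d - b0"
  have gap: "gap > 0" using beta_zero by (simp add: gap_def)
  define c where "c = 3 / 4 + ln (2 * real l / (real d * b0)) / 2 - ln gap / 2 + (rate - 1 - ln rate) / 2"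
  fix m h
  assume dvd: "d dvd l * m" and h: "h \<ge> 1" "d * h \<le> m" "b0 * real m / 2 \<le> real h" "centre m \<le> real h"
  obtain k where k: "l * m = d * k" using dvd by blast
  define i where "i = real h - centre m"
  have i: "i \<ge> 0" using h by (simp add: i_def)
  have pos: "d > 0" "l > 0" "real d > 0" "real l > 0" "real h > 0" using d_ge l_ge h by auto
  have hm: "h \<le> m" using h(2) mult_le_mono1[of 1 d h] pos by linarith
  have m: "real m > 0" using hm h by simp
  have K: "real k = real l * real m / real d"
    using k pos by (simp add: field_simps flip: of_nat_mult)
  have k0: "real k > 0" using K pos m by simp
  have lhk: "l * h \<le> k" using half_edges_le_vertices[OF pos(1) k h(2)] .
  have bounds: "0 < real h / real m" "real h / real m \<le> 1 / real d"
    using h(2) m pos by (simp_all add: field_simps flip: of_nat_mult)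
  let ?E = "measure_pmf.expectation (random_configuration m d l) (\<lambda>G. real (num_matchings m l G h))"
  let ?W = "real (m choose h) * real (k choose (l * h)) * real d ^ (l * h) / real (l * m choose (l * h))"
  have W: "real (m choose h) > 0" "real (k choose (l * h)) > 0" "real d ^ (l * h) > 0"
      "real (l * m choose (l * h)) > 0"
    using hm lhk pos by (simp_all add: zero_less_binomial mult_le_mono2)
  have lnW: "ln ?W = ln (real (m choose h)) + ln (real (k choose (l * h))) + real (l * h) * ln (real d)
       - ln (real (l * m choose (l * h)))"
    using W pos by (simp add: ln_div ln_mult ln_realpow)
  have "ln ?W \<le> real m * Phi d l (real h / real m)
       + (ln (real k) - ln (real h) - ln (real k - real l * real h + 1)) / 2 + 3 / 4"
    unfolding lnW using ln_matching_weight_le[OF d_ge pos(2) k h(1,2)] .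
  moreover have "real m * Phi d l (real h / real m) \<le> - (rate * i) + ln (real m) / 2"
  proof -
    have "real m * Phi d l (real h / real m) \<le> real m * (- rate * (real h / real m - b0))"
      using Phi_le_tangent[OF bounds] m by (intro mult_left_mono) (auto simp: rate_def)
    also have "\<dots> = - rate * (real h - real m * b0)" using m by (simp add: field_simps)
    also have "\<dots> = - (rate * i) + ln (real m) / 2"
      using rate_pos by (simp add: i_def centre_def field_simps)
    finally show ?thesis .
  qed
  moreover have "ln (real k) - ln (real h) \<le> ln (2 * real l / (real d * b0))"
  proof -
    have "real k / real h \<le> 2 * real l / (real d * b0)"
      using h(3) pos m beta_zero by (simp add: K field_simps)
    then have "ln (real k / real h) \<le> ln (2 * real l / (real d * b0))"
      using k0 pos by (intro ln_mono) auto
    then show ?thesis using k0 pos by (simp add: ln_div)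
  qed
  \<comment> \<open>The distance \<open>m * gap\<close> from \<open>b0 * m\<close> to
    \<open>m / d\<close> is the sum of \<open>y\<close> and \<open>h - m * b0\<close>, and the
    latter is at most \<open>i\<close>. So \<open>m * gap\<close> is at most y + i, hence at most (1
    + i) (1 + y), which stays valid up to the end point y = 0.\<close>
  moreover have "ln (real m) - ln (real k - real l * real h + 1) \<le> ln (1 + i) - ln gap"
  proof -
    define y where "y = real m / real d - real h"
    have y0: "y \<ge> 0" using bounds m pos by (simp add: y_def field_simps)
    have y: "real k - real l * real h = real l * y" by (simp add: y_def K algebra_simps)
    have "ln (real m) \<ge> 0" using hm h by simp
    then have "0 \<le> ln (real m) / (2 * rate)" using rate_pos by simp
    then have "real h - real m * b0 \<le> i" by (simp add: i_def centre_def)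
    moreover have "real m * gap = y + (real h - real m * b0)"
      by (simp add: gap_def y_def algebra_simps)
    ultimately have "real m * gap \<le> y + i" by simp
    also have "\<dots> \<le> (1 + i) * (1 + y)" using i y0 by (simp add: algebra_simps)
    also have "\<dots> \<le> (1 + i) * (real l * y + 1)"
      using i y0 l_ge mult_right_mono[of 1 "real l" y] by (intro mult_left_mono) auto
    finally have "ln (real m * gap) \<le> ln ((1 + i) * (real l * y + 1))"
      using m gap by (intro ln_mono) auto
    moreover have "real l * y + 1 > 0" using y0 by (simp add: add_nonneg_pos)
    ultimately show ?thesis unfolding y using m gap i by (simp add: ln_mult)
  qed
  \<comment> \<open>The inequality ln x \<le> x - 1 at x = (1 + i) \<open>rate\<close>; the scaling
    produces exactly the slope \<open>rate\<close>.\<close>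
  moreover have "ln (1 + i) \<le> rate * i + (rate - 1 - ln rate)"
  proof -
    have "ln ((1 + i) * rate) \<le> (1 + i) * rate - 1"
      using rate_pos i by (intro ln_le_minus_one) simp
    moreover have "ln ((1 + i) * rate) = ln (1 + i) + ln rate"
      using rate_pos i by (intro ln_mult_pos) auto
    ultimately show ?thesis by (simp add: algebra_simps)
  qed
  moreover have "rate / 2 * i = rate * i / 2" by simp
  ultimately have "ln ?W \<le> c - rate / 2 * i"
    unfolding c_def diff_divide_distrib add_divide_distrib by linarith
  then have "exp (ln ?W) \<le> exp (c - rate / 2 * i)" by (simp only: exp_le_cancel_iff)
  moreover have "?W > 0" using W by (intro divide_pos_pos mult_pos_pos)
  ultimately have "?W \<le> exp (c - rate / 2 * i)" by (simp only: exp_ln)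
  then show "?E \<le> exp (c - rate / 2 * (real h - centre m))"
    using expectation_num_matchings_le[OF pos(2,1) k hm] unfolding i_def by linarith
qed

text \<open>The logarithmic shift is negligible against m. For large m every h above the centre
  therefore satisfies the linear lower bound of the preceding lemma and is positive.\<close>

lemma eventually_centre_ge: "eventually (\<lambda>m. b0 * real m / 2 \<le> centre m \<and> m \<ge> 1) sequentially"
proof -
  have "rate * b0 > 0" using rate_pos beta_zero by simp
  then have "eventually (\<lambda>m. ln (real m) \<le> rate * b0 * real m) sequentially"
    by real_asymp
  then show ?thesis
    using eventually_ge_at_top[of 1]
  proof eventually_elim
    case (elim m)
    then have "ln (real m) / (2 * rate) \<le> rate * b0 * real m / (2 * rate)"
      using rate_pos by (intro divide_right_mono) auto
    also have "\<dots> = b0 * real m / 2" using rate_pos by simp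
    finally show ?case using elim by (simp add: centre_def algebra_simps)
  qed
qed

text \<open>Summing the exponential bounds gives a geometric series of ratio exp (-
  \<open>rate\<close> / 2), dominated by its first term; \<open>A\<close> depends on neither C nor
  m.\<close>

lemma expectation_tail_le:
  obtains A where "\<And>C. C \<ge> 1 \<Longrightarrow> eventually (\<lambda>m. measure_pmf.expectation (random_configuration m d l)
      (\<lambda>G. real (num_matchings_ge m d l G (real_of_int (threshold m d l) + C)))
        \<le> A * exp (- (rate / 2 * C))) (sizes_at_top d l)"
proof -
  obtain c where c: "\<And>m h. d dvd l * m \<Longrightarrow> h \<ge> 1 \<Longrightarrow> d * h \<le> m \<Longrightarrow> b0 * real m / 2 \<le> real h
      \<Longrightarrow> centre m \<le> real h
      \<Longrightarrow> measure_pmf.expectation (random_configuration m d l) (\<lambda>G. real (num_matchings m l G h))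
          \<le> exp (c - rate / 2 * (real h - centre m))"
    by (rule expectation_num_matchings_exponential) (rule that)
  define r where "r = exp (- (rate / 2))"
  have r: "0 < r" "r < 1" using rate_pos by (auto simp: r_def)
  have r_pow: "r ^ n = exp (- (rate / 2 * real n))" for n
    by (simp add: r_def flip: exp_of_nat_mult)
  \<comment> \<open>The summand \<open>rate / 2\<close> pays for the rounding of the threshold,
    which loses at most 1; the denominator comes from the geometric series.\<close>
  define A where "A = exp (c + rate / 2) / (1 - r)"
  show thesis
  proof
    fix C :: real assume C: "C \<ge> 1"
    have "eventually (\<lambda>m. (b0 * real m / 2 \<le> centre m \<and> m \<ge> 1) \<and> d dvd l * m) (sizes_at_top d l)"
      unfolding sizes_at_top_def eventually_inf_principal
      using eventually_centre_ge by eventually_elim auto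
    then show "eventually (\<lambda>m. measure_pmf.expectation (random_configuration m d l)
      (\<lambda>G. real (num_matchings_ge m d l G (real_of_int (threshold m d l) + C)))
        \<le> A * exp (- (rate / 2 * C))) (sizes_at_top d l)"
    proof eventually_elim
      case (elim m)
      define n0 n1 where "n0 = nat \<lceil>real_of_int (threshold m d l) + C\<rceil>" and "n1 = nat \<lfloor>real m / real d\<rfloor>"
      let ?E = "\<lambda>f. measure_pmf.expectation (random_configuration m d l) f"
      have d0: "d > 0" using d_ge by simp
      \<comment> \<open>The floor costs less than 1, the ceiling only helps, and \<open>nat\<close>
        can only raise a negative value.\<close>
      have n0: "centre m + C - 1 \<le> real n0"
        unfolding n0_def threshold_eq by linarith
      have "?E (\<lambda>G. real (num_matchings_ge m d l G (real_of_int (threshold m d l) + C)))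
          = (\<Sum>h=n0..n1. ?E (\<lambda>G. real (num_matchings m l G h)))"
        using elim d0 unfolding num_matchings_ge_def n0_def[symmetric] n1_def[symmetric]
        by (simp add: expectation_random_configuration sum.swap[of _ "{n0..n1}"]
            flip: sum_divide_distrib)
      also have "\<dots> \<le> (\<Sum>h=n0..n1. exp (c + rate / 2 * centre m) * r ^ h)"
      proof (rule sum_mono)
        fix h assume h: "h \<in> {n0..n1}"
        have "real h \<le> real n1" using h by simp
        also have "\<dots> \<le> real m / real d" unfolding n1_def by (rule of_nat_floor) simp
        finally have "real (d * h) \<le> real m" using d0 by (simp add: field_simps)
        then have "d * h \<le> m" by (simp only: of_nat_le_iff)
        moreover have "real n0 \<le> real h" using h by simp
        then have "centre m \<le> real h" using n0 C by linarith
        moreover have "b0 * real m / 2 > 0" using beta_zero elim by simp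
        ultimately have "?E (\<lambda>G. real (num_matchings m l G h)) \<le> exp (c - rate / 2 * (real h - centre m))"
          using elim by (intro c) auto
        also have "\<dots> = exp (c + rate / 2 * centre m) * r ^ h"
          unfolding r_pow by (simp add: field_simps flip: exp_add)
        finally show "?E (\<lambda>G. real (num_matchings m l G h)) \<le> exp (c + rate / 2 * centre m) * r ^ h" .
      qed
      also have "\<dots> = exp (c + rate / 2 * centre m) * (\<Sum>h=n0..n1. r ^ h)"
        by (simp add: sum_distrib_left)
      also have "\<dots> \<le> exp (c + rate / 2 * centre m) * (r ^ n0 / (1 - r))"
        \<comment> \<open>The formula \<open>sum_gp\<close> has a separate case for an empty range,
          where the sum is 0 and the bound still holds.\<close>
        using r by (intro mult_left_mono) (auto simp: sum_gp divide_right_mono)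
      also have "\<dots> = exp (c - rate / 2 * (real n0 - centre m)) / (1 - r)"
        unfolding r_pow by (simp add: field_simps flip: exp_add)
      also have "\<dots> \<le> exp (c + rate / 2 - rate / 2 * C) / (1 - r)"
      proof -
        have "rate / 2 * (C - 1) \<le> rate / 2 * (real n0 - centre m)"
          using n0 rate_pos by (intro mult_left_mono) auto
        then show ?thesis using r by (intro divide_right_mono) (auto simp: field_simps)
      qed
      also have "\<dots> = A * exp (- (rate / 2 * C))"
        by (simp add: A_def flip: exp_add)
      finally show ?case .
    qed
  qed
qed

section \<open>Markov inequality and passage to the limits\<close>

lemma prob_le_expectation:
  assumes "d dvd l * m"
  shows "measure_pmf.prob (random_configuration m d l) {G. real (matching_number m l G) \<ge> k}
     \<le> measure_pmf.expectation (random_configuration m d l) (\<lambda>G. real (num_matchings_ge m d l G k))"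
proof -
  let ?U = "configurations m d l" and ?A = "{G. real (matching_number m l G) \<ge> k}"
  have pos: "d > 0" "l > 0" using d_ge l_ge by auto
  note U = configurations_nonempty[OF pos(1) assms] finite_configurations[of m d l]
  have "measure_pmf.prob (random_configuration m d l) ?A = real (card (?U \<inter> ?A)) / card ?U"
    unfolding random_configuration_def using U by (rule measure_pmf_of_set)
  \<comment> \<open>Markov's inequality at level 1 as a comparison of finite sums: on the event the
    count is a positive integer.\<close>
  also have "\<dots> \<le> (\<Sum>G\<in>?U. real (num_matchings_ge m d l G k)) / card ?U"
  proof (intro divide_right_mono)
    have "real (card (?U \<inter> ?A)) = (\<Sum>G\<in>?U \<inter> ?A. 1)" by simp
    also have "\<dots> \<le> (\<Sum>G\<in>?U \<inter> ?A. real (num_matchings_ge m d l G k))"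
    proof (rule sum_mono)
      fix G assume "G \<in> ?U \<inter> ?A"
      then have "1 \<le> num_matchings_ge m d l G k" using matching_number_le_sum[OF pos(2,1)] by blast
      then show "1 \<le> real (num_matchings_ge m d l G k)" by simp
    qed
    also have "\<dots> \<le> (\<Sum>G\<in>?U. real (num_matchings_ge m d l G k))"
      using U by (intro sum_mono2) auto
    finally show "real (card (?U \<inter> ?A)) \<le> (\<Sum>G\<in>?U. real (num_matchings_ge m d l G k))" .
  qed simp
  finally show ?thesis by (simp add: expectation_random_configuration[OF pos(1) assms])
qed

text \<open>Multiples of \<open>d\<close> are admissible and unbounded. Along a trivial filter
  \<open>Limsup\<close> would be minus infinity, and the lower bound 0 would fail.\<close>

lemma sizes_at_top_neq_bot: "sizes_at_top d l \<noteq> bot"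
proof
  assume "sizes_at_top d l = bot"
  then have "eventually (\<lambda>m. \<not> d dvd l * m) at_top"
    by (simp add: sizes_at_top_def trivial_limit_def eventually_inf_principal)
  then obtain n where "\<forall>m\<ge>n. \<not> d dvd l * m" by (auto simp: eventually_at_top_linorder)
  moreover have "d * n \<ge> n" using d_ge by simp
  moreover have "d dvd l * (d * n)" by simp
  ultimately show False by blast
qed

text \<open>For each fixed C the upper limit in m lies between 0 and the exponential bound, which no
  longer involves m; letting C grow squeezes it to 0.\<close>

lemma Limsup_exponential_tendsto_0:
  fixes f :: "real \<Rightarrow> nat \<Rightarrow> real"
  assumes "b > 0" and nonneg: "\<And>C m. 0 \<le> f C m"
    and bound: "\<And>C. C \<ge> 1 \<Longrightarrow> eventually (\<lambda>m. f C m \<le> A * exp (- (b * C))) (sizes_at_top d l)"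
  shows "((\<lambda>C. Limsup (sizes_at_top d l) (\<lambda>m. ereal (f C m))) \<longlongrightarrow> 0) at_top"
proof (rule tendsto_sandwich)
  show "eventually (\<lambda>C. 0 \<le> Limsup (sizes_at_top d l) (\<lambda>m. ereal (f C m))) at_top"
    using nonneg by (intro always_eventually allI le_Limsup sizes_at_top_neq_bot) auto
  show "eventually (\<lambda>C. Limsup (sizes_at_top d l) (\<lambda>m. ereal (f C m)) \<le> ereal (A * exp (- (b * C)))) at_top"
    using eventually_ge_at_top[of 1]
    by eventually_elim (intro Limsup_bounded, use bound in simp)
  have "((\<lambda>C. A * exp (- (b * C))) \<longlongrightarrow> 0) at_top"
    using assms(1) by real_asymp
  then show "((\<lambda>C. ereal (A * exp (- (b * C)))) \<longlongrightarrow> 0) at_top"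
    by (simp add: zero_ereal_def)
qed simp

end

theorem proposition8p2:
  fixes d l :: nat
  assumes "d \<ge> 2" and "l \<ge> 2"
    and "(real l - 1) * (real d - 1) / real d * ln ((real d - 1) / real d)
           - 1 / real d * ln (1 / real d) < 0"
  shows "(\<exists>!\<beta>. is_beta_star d l \<beta>)
    \<and> (\<exists>!\<beta>. is_beta_zero d l \<beta>)
    \<and> deriv (Phi d l) (beta_zero d l) < 0
    \<and> ((\<lambda>C::real. Limsup (sizes_at_top d l) (\<lambda>m. ereal
          (measure_pmf.expectation (random_configuration m d l)
            (\<lambda>G. real (num_matchings_ge m d l G (real_of_int (threshold m d l) + C))))))
         \<longlongrightarrow> 0) at_top
    \<and> ((\<lambda>C::real. Limsup (sizes_at_top d l) (\<lambda>m. ereal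
          (measure_pmf.prob (random_configuration m d l)
            {G. real (matching_number m l G) \<ge> real_of_int (threshold m d l) + C})))
         \<longlongrightarrow> 0) at_top"
proof -
  interpret matching_threshold d l using assms by unfold_locales
  obtain A where A: "\<And>C. C \<ge> 1 \<Longrightarrow> eventually (\<lambda>m. measure_pmf.expectation (random_configuration m d l)
      (\<lambda>G. real (num_matchings_ge m d l G (real_of_int (threshold m d l) + C)))
        \<le> A * exp (- (rate / 2 * C))) (sizes_at_top d l)"
    using expectation_tail_le by blast
  have B: "eventually (\<lambda>m. measure_pmf.prob (random_configuration m d l)
            {G. real (matching_number m l G) \<ge> real_of_int (threshold m d l) + C}
        \<le> A * exp (- (rate / 2 * C))) (sizes_at_top d l)" if "C \<ge> 1" for C
  proof -
    have "eventually (\<lambda>m. d dvd l * m) (sizes_at_top d l)"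
      by (simp add: sizes_at_top_def eventually_inf_principal)
    with A[OF that] show ?thesis
    proof eventually_elim
      case (elim m)
      then show ?case using prob_le_expectation order_trans by blast
    qed
  qed
  show ?thesis
    using ex1_beta_star ex1_beta_zero dPhi_beta_zero_neg rate_pos A B
    by (intro conjI Limsup_exponential_tendsto_0[where A = A and b = "rate / 2"])
       (simp_all add: deriv_Phi_beta_zero)
qed

end
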